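(* Let $G$ be a graph with minimum degree $\delta(G)$. For each integer $t$ with $1\leq t\leq \delta(G)+1$, one has $t\in \mathrm{Fall}(G)$ if and only if $t\in\{\chi(H) : H\in\widehat{G_t}\}$. In particular, $$\mathrm{Fall}(G)=\bigcup_{i=1}^{\delta(G)+1}\left(\{\chi(H) : H\in\widehat{G_i}\}\cap\{i\}\right).$$
   Context: All graphs are finite, simple (undirected, no loops, no multiple edges), with nonempty vertex set. For $k\in\mathbb{N}=\{1,2,\dots\}$ let $[k]=\{1,\dots,k\}$. A (proper) $k$-coloring of a graph $G$ is a function $f:V(G)\to[k]$ such that each $f^{-1}(i)$ is an independent set; $\chi(G)$ is the chromatic number. A $k$-coloring $f$ is a fall $k$-coloring if $f(N[v])=[k]$ for every $v\in V(G)$, where $N[v]$ is the closed neighborhood of $v$. $\mathrm{Fall}(G)$ is the set of all positive integers $k$ such that $G$ has a fall $k$-coloring. For a graph $G$ and $1\leq t\leq\delta(G)+1$, the set $\widehat{G_t}$ is the set of all graphs $H$ on the vertex set $V(G)$ obtained as follows: for each $v\in V(G)$ choose an arbitrary set $A_v$ of $t-1$ elements of the open neighborhood $N_G(v)$ and, for every $v$, join the vertices of $A_v$ pairwise to each other; that is, $E(H)=E(G)\cup\bigcup_{v\in V(G)}\{\{a,b\} : a,b\in A_v,\ a\neq b\}$. *)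

theory Defs
  imports "Graph_Theory.Pair_Digraph"
begin

text \<open>
  A finite simple graph is a \<^locale>\<open>pair_graph\<close>: a finite vertex set together with a symmetric
  irreflexive edge relation on it. An undirected edge is thus represented by both of its
  orientations, and the degree of a vertex is its \<^const>\<open>out_degree\<close>. The locale admits the graph
  without vertices, so nonemptiness has to be assumed separately.
\<close>

definition nbhd :: "'a pair_pre_digraph \<Rightarrow> 'a \<Rightarrow> 'a set" where
  "nbhd G v = {w. (v, w) \<in> parcs G}"

definition closed_nbhd :: "'a pair_pre_digraph \<Rightarrow> 'a \<Rightarrow> 'a set" where
  "closed_nbhd G v = insert v (nbhd G v)"

lemma out_degree_eq_card_nbhd: "out_degree (with_proj G) v = card (nbhd G v)"
proof -
  have "out_arcs (with_proj G) v = Pair v ` nbhd G v"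
    by (auto simp: out_arcs_def nbhd_def image_iff)
  then show ?thesis
    unfolding out_degree_def by (simp add: card_image inj_on_def)
qed

definition min_degree :: "'a pair_pre_digraph \<Rightarrow> nat" where
  "min_degree G = Min ((\<lambda>v. out_degree (with_proj G) v) ` pverts G)"

definition independent_set :: "'a pair_pre_digraph \<Rightarrow> 'a set \<Rightarrow> bool" where
  "independent_set G S \<longleftrightarrow> S \<subseteq> pverts G \<and> (\<forall>u\<in>S. \<forall>v\<in>S. (u, v) \<notin> parcs G)"

text \<open>Only the values of a coloring on the vertex set matter.\<close>

definition coloring :: "'a pair_pre_digraph \<Rightarrow> nat \<Rightarrow> ('a \<Rightarrow> nat) \<Rightarrow> bool" where
  "coloring G k f \<longleftrightarrow>
     f ` pverts G \<subseteq> {1..k} \<and> (\<forall>i\<in>{1..k}. independent_set G {v \<in> pverts G. f v = i})"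

definition chromatic_number :: "'a pair_pre_digraph \<Rightarrow> nat" where
  "chromatic_number G = (LEAST k. \<exists>f. coloring G k f)"

definition fall_coloring :: "'a pair_pre_digraph \<Rightarrow> nat \<Rightarrow> ('a \<Rightarrow> nat) \<Rightarrow> bool" where
  "fall_coloring G k f \<longleftrightarrow>
     coloring G k f \<and> (\<forall>v\<in>pverts G. f ` closed_nbhd G v = {1..k})"

definition Fall :: "'a pair_pre_digraph \<Rightarrow> nat set" where
  "Fall G = {k. 1 \<le> k \<and> (\<exists>f. fall_coloring G k f)}"

definition join_within :: "'a pair_pre_digraph \<Rightarrow> ('a \<Rightarrow> 'a set) \<Rightarrow> 'a pair_pre_digraph" where
  "join_within G A =
     \<lparr> pverts = pverts G,
       parcs = parcs G \<union> (\<Union>v\<in>pverts G. {(a, b). a \<in> A v \<and> b \<in> A v \<and> a \<noteq> b}) \<rparr>"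

text \<open>
  The subtraction \<open>t - 1\<close> is truncated, so this has the intended meaning only for \<open>t \<ge> 1\<close>.
\<close>

definition hat :: "'a pair_pre_digraph \<Rightarrow> nat \<Rightarrow> 'a pair_pre_digraph set" where
  "hat G t =
     {join_within G A | A. \<forall>v\<in>pverts G. A v \<subseteq> nbhd G v \<and> card (A v) = t - 1}"

lemma pair_graph_hat:
  assumes "pair_graph G" and "H \<in> hat G t"
  shows "pair_graph H"
proof -
  interpret pair_graph G by fact
  obtain A where H: "H = join_within G A"
    and A: "\<And>v. v \<in> pverts G \<Longrightarrow> A v \<subseteq> nbhd G v"
    using assms(2) unfolding hat_def by blast
  have sub: "parcs H \<subseteq> pverts G \<times> pverts G"
    using A by (fastforce simp: H join_within_def nbhd_def dest: in_arcsD1 in_arcsD2)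
  then have fin: "finite (parcs H)"
    using pair_finite_verts finite_subset by blast
  have vs: "pverts H = pverts G"
    by (simp add: H join_within_def)
  have sym: "sym (parcs H)"
    by (auto simp: H join_within_def sym_def dest: arcs_symmetric)
  have irr: "fst e \<noteq> snd e" if "e \<in> parcs H" for e
    using that by (auto simp: H join_within_def dest: pair_no_loops)
  show ?thesis
  proof unfold_locales
    show "symmetric (with_proj H)"
      using sym by (simp add: symmetric_def)
  qed (use sub fin vs irr pair_finite_verts in auto)
qed

end

theory Submission
  imports Defs
begin

text \<open>
  In every \<open>H \<in> hat G t\<close> each vertex \<open>v\<close> forms a clique of size \<open>t\<close> together with the set
  \<open>A v\<close> chosen for it. Hence a \<open>t\<close>-coloring of \<open>H\<close> restricts to a bijection from each of these
  cliques onto the colors, which makes it a fall coloring of \<open>G\<close>. Conversely, a fall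
  \<open>t\<close>-coloring of \<open>G\<close> lets us choose \<open>A v\<close> as a rainbow set of neighbors avoiding the color of
  \<open>v\<close>; it remains proper after joining these sets, and the cliques show that fewer than \<open>t\<close>
  colors do not suffice.
\<close>

lemma pair_graph_arc:
  assumes "pair_graph G" "(u, v) \<in> parcs G"
  shows "u \<in> pverts G" "v \<in> pverts G" "u \<noteq> v" "(v, u) \<in> parcs G"
proof -
  have fin: "pair_fin_digraph G" and sym: "pair_sym_digraph G" and loopfree: "pair_loopfree_digraph G"
    using assms(1) pair_graph.axioms pair_digraph.axioms pair_pseudo_graph.axioms by blast+
  note wf = pair_fin_digraph.axioms(1)[OF fin]
  show "u \<in> pverts G" "v \<in> pverts G"
    using pair_wf_digraph.in_arcsD1[OF wf assms(2)] pair_wf_digraph.in_arcsD2[OF wf assms(2)] .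
  show "u \<noteq> v"
    using pair_loopfree_digraph.pair_no_loops[OF loopfree assms(2)] by simp
  show "(v, u) \<in> parcs G"
    using pair_sym_digraph.arcs_symmetric[OF sym assms(2)] .
qed

lemma finite_pverts: "pair_graph G \<Longrightarrow> finite (pverts G)"
  by (intro pair_fin_digraph.pair_finite_verts pair_digraph.axioms(1) pair_graph.axioms(1))

lemma nbhd_subset_pverts: "pair_graph G \<Longrightarrow> nbhd G v \<subseteq> pverts G"
  using pair_graph_arc(2) unfolding nbhd_def by fast

lemma finite_nbhd: "pair_graph G \<Longrightarrow> finite (nbhd G v)"
  using finite_subset[OF nbhd_subset_pverts finite_pverts] .

lemma not_in_nbhd_self: "pair_graph G \<Longrightarrow> v \<notin> nbhd G v"
  using pair_graph_arc(3) unfolding nbhd_def by fast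

text \<open>Every arc has both ends in \<open>pverts G\<close>, so independence of the color classes
  becomes a condition on arcs alone. In this form colorings of \<open>G\<close> and of a graph in
  \<open>hat G t\<close> can be compared through their arc sets.\<close>

lemma coloring_iff:
  assumes "pair_graph G"
  shows "coloring G k f \<longleftrightarrow> f ` pverts G \<subseteq> {1..k} \<and> (\<forall>u v. (u, v) \<in> parcs G \<longrightarrow> f u \<noteq> f v)"
proof
  assume f: "coloring G k f"
  have "f u \<noteq> f v" if uv: "(u, v) \<in> parcs G" for u v
  proof
    assume "f u = f v"
    have "u \<in> pverts G" "v \<in> pverts G"
      using pair_graph_arc[OF assms uv] by blast+
    moreover from this f have "independent_set G {w \<in> pverts G. f w = f u}"
      unfolding coloring_def by blast
    ultimately show False
      using uv \<open>f u = f v\<close> unfolding independent_set_def by simp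
  qed
  with f show "f ` pverts G \<subseteq> {1..k} \<and> (\<forall>u v. (u, v) \<in> parcs G \<longrightarrow> f u \<noteq> f v)"
    unfolding coloring_def by blast
next
  assume "f ` pverts G \<subseteq> {1..k} \<and> (\<forall>u v. (u, v) \<in> parcs G \<longrightarrow> f u \<noteq> f v)"
  then show "coloring G k f"
    unfolding coloring_def independent_set_def by auto metis
qed

text \<open>The \<open>LEAST\<close> in \<open>chromatic_number\<close> is attained only once some
  coloring exists; giving all vertices distinct colors provides one.\<close>

lemma ex_coloring:
  assumes "pair_graph G"
  shows "\<exists>k f. coloring G k f"
proof -
  obtain f :: "'a \<Rightarrow> nat" and n where "f ` pverts G = {i. i < n}" and inj: "inj_on f (pverts G)"
    using finite_imp_inj_to_nat_seg[OF finite_pverts[OF assms]] by blast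
  \<comment> \<open>The numbering starts at 0 and colors start at 1, hence the shift by
    \<open>Suc\<close>.\<close>
  then have "(\<lambda>v. Suc (f v)) ` pverts G \<subseteq> {1..n}"
    by (auto simp: Suc_le_eq)
  moreover have "f u \<noteq> f v" if "(u, v) \<in> parcs G" for u v
    using pair_graph_arc[OF assms that] inj by (auto dest: inj_onD)
  ultimately have "coloring G n (\<lambda>v. Suc (f v))"
    unfolding coloring_iff[OF assms] by simp
  then show ?thesis
    by blast
qed

lemma coloring_chromatic_number:
  "pair_graph G \<Longrightarrow> \<exists>f. coloring G (chromatic_number G) f"
  unfolding chromatic_number_def by (rule LeastI_ex) (rule ex_coloring)

lemma coloring_inj_on_clique:
  assumes "pair_graph G" "coloring G k f"
    and "\<And>u v. u \<in> C \<Longrightarrow> v \<in> C \<Longrightarrow> u \<noteq> v \<Longrightarrow> (u, v) \<in> parcs G"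
  shows "inj_on f C"
  using assms(2,3) unfolding coloring_iff[OF assms(1)] inj_on_def by blast

text \<open>Two members of \<open>A v\<close> are joined by construction, while \<open>v\<close> and
  a member of \<open>A v\<close> are already adjacent in \<open>G\<close>.\<close>

lemma join_within_closed_clique:
  assumes "pair_graph G" "v \<in> pverts G" "A v \<subseteq> nbhd G v"
    and "a \<in> insert v (A v)" "b \<in> insert v (A v)" "a \<noteq> b"
  shows "(a, b) \<in> parcs (join_within G A)"
  using assms(2-) pair_graph_arc(4)[OF assms(1)] by (auto simp: join_within_def nbhd_def)

text \<open>A coloring is injective on the clique \<open>insert v (A v)\<close>. The number
  \<open>k\<close> of colors is kept apart from the clique size \<open>t\<close>: for
  \<open>k = t\<close> all colors occur on the clique, and for arbitrary \<open>k\<close> the bound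
  \<open>t \<le> k\<close> follows.\<close>

lemma coloring_join_within_image:
  assumes "pair_graph G" "pair_graph (join_within G A)" "coloring (join_within G A) k f"
    and "t \<ge> 1" "v \<in> pverts G" "A v \<subseteq> nbhd G v" "card (A v) = t - 1"
  shows "f ` insert v (A v) \<subseteq> {1..k}" "card (f ` insert v (A v)) = t"
proof -
  have "f ` pverts G \<subseteq> {1..k}"
    using assms(3) unfolding coloring_iff[OF assms(2)] by (simp add: join_within_def)
  then show "f ` insert v (A v) \<subseteq> {1..k}"
    using assms(5,6) nbhd_subset_pverts[OF assms(1), of v] by blast
  have "inj_on f (insert v (A v))"
    using join_within_closed_clique[of G v A, OF assms(1,5,6)]
    by (rule coloring_inj_on_clique[OF assms(2,3)])
  \<comment> \<open>Since \<open>v\<close> is not its own neighbor, the size is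
    \<open>Suc (t - 1)\<close>, which equals \<open>t\<close> because
    \<open>t \<ge> 1\<close>.\<close>
  moreover have "card (insert v (A v)) = t"
  proof -
    have "finite (A v)" "v \<notin> A v"
      using assms(6) finite_subset[OF _ finite_nbhd[OF assms(1)]] not_in_nbhd_self[OF assms(1)]
      by blast+
    then show ?thesis
      using assms(4,7) by simp
  qed
  ultimately show "card (f ` insert v (A v)) = t"
    using card_image by metis
qed

lemma Fall_if_chromatic_number_hat:
  assumes "pair_graph G" "t \<ge> 1" "H \<in> hat G t" "chromatic_number H = t"
  shows "t \<in> Fall G"
proof -
  obtain A where H: "H = join_within G A"
    and A: "\<And>v. v \<in> pverts G \<Longrightarrow> A v \<subseteq> nbhd G v" "\<And>v. v \<in> pverts G \<Longrightarrow> card (A v) = t - 1"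
    using assms(3) unfolding hat_def by blast
  have H_graph: "pair_graph H"
    using pair_graph_hat[OF assms(1,3)] .
  obtain f where f: "coloring H t f"
    using coloring_chromatic_number[OF H_graph] assms(4) by blast
  \<comment> \<open>\<open>H\<close> has the vertices of \<open>G\<close> and contains all its arcs,
    so a coloring of \<open>H\<close> also colors \<open>G\<close>.\<close>
  then have fG: "coloring G t f"
    unfolding coloring_iff[OF assms(1)] coloring_iff[OF H_graph] by (simp add: H join_within_def)
  have "f ` closed_nbhd G v = {1..t}" if v: "v \<in> pverts G" for v
  proof
    have "f ` pverts G \<subseteq> {1..t}"
      using fG unfolding coloring_def by blast
    then show "f ` closed_nbhd G v \<subseteq> {1..t}"
      using v nbhd_subset_pverts[OF assms(1), of v] unfolding closed_nbhd_def by blast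
    note image = coloring_join_within_image[OF assms(1) H_graph[unfolded H] f[unfolded H]
        assms(2) v A(1)[OF v] A(2)[OF v]]
    \<comment> \<open>A subset of \<open>{1..t}\<close> with \<open>t\<close> elements is all of
      it.\<close>
    have "f ` insert v (A v) = {1..t}"
      by (rule card_subset_eq) (use image in simp_all)
    then show "{1..t} \<subseteq> f ` closed_nbhd G v"
      using A(1)[OF v] unfolding closed_nbhd_def by blast
  qed
  then show ?thesis
    using assms(2) fG unfolding Fall_def fall_coloring_def by blast
qed

lemma chromatic_number_hat_if_Fall:
  assumes "pair_graph G" "pverts G \<noteq> {}" "t \<in> Fall G"
  shows "\<exists>H \<in> hat G t. chromatic_number H = t"
proof -
  obtain f where t: "t \<ge> 1" and f: "coloring G t f"
    and fall: "\<And>v. v \<in> pverts G \<Longrightarrow> f ` closed_nbhd G v = {1..t}"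
    using assms(3) unfolding Fall_def fall_coloring_def by blast
  \<comment> \<open>\<open>B\<close> picks exactly one neighbor of \<open>v\<close> for each color
    other than \<open>f v\<close>. All these colors occur on \<open>nbhd G v\<close>, since
    \<open>v\<close> itself accounts only for \<open>f v\<close>.\<close>
  have "\<exists>B. B \<subseteq> nbhd G v \<and> inj_on f B \<and> {1..t} - {f v} = f ` B" if v: "v \<in> pverts G" for v
  proof -
    have "{1..t} - {f v} \<subseteq> f ` nbhd G v"
      using fall[OF v] by (auto simp: closed_nbhd_def)
    then show ?thesis
      unfolding subset_image_inj .
  qed
  then obtain A where A: "\<And>v. v \<in> pverts G \<Longrightarrow>
      A v \<subseteq> nbhd G v \<and> inj_on f (A v) \<and> {1..t} - {f v} = f ` A v"
    by metis
  have card_A: "card (A v) = t - 1" if v: "v \<in> pverts G" for v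
  proof -
    have "f v \<in> {1..t}"
      using f v unfolding coloring_def by blast
    then have "card ({1..t} - {f v}) = t - 1"
      by simp
    then show ?thesis
      using A[OF v] card_image[of f "A v"] by simp
  qed
  define H where "H = join_within G A"
  have hat: "H \<in> hat G t"
    using A card_A unfolding hat_def H_def by blast
  have H_graph: "pair_graph H"
    using pair_graph_hat[OF assms(1) hat] .
  have "f a \<noteq> f b" if ab: "(a, b) \<in> parcs H" for a b
  proof -
    \<comment> \<open>An old arc is handled by properness of \<open>f\<close> on \<open>G\<close>, a
      new one by injectivity of \<open>f\<close> on \<open>A v\<close>.\<close>
    consider "(a, b) \<in> parcs G" | v where "v \<in> pverts G" "a \<in> A v" "b \<in> A v" "a \<noteq> b"
      using ab unfolding H_def join_within_def by auto
    then show ?thesis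
    proof cases
      case 1
      then show ?thesis
        using f unfolding coloring_iff[OF assms(1)] by blast
    next
      case 2
      then show ?thesis
        using A[of v] inj_onD[of f "A v" a b] by blast
    qed
  qed
  then have fH: "coloring H t f"
    using f unfolding coloring_iff[OF assms(1)] coloring_iff[OF H_graph]
    by (simp add: H_def join_within_def)
  have "t \<le> k" if g: "coloring H k g" for k g
  proof -
    \<comment> \<open>Nonemptiness provides a vertex, and its clique of size \<open>t\<close> forces
      at least \<open>t\<close> colors.\<close>
    obtain v where v: "v \<in> pverts G"
      using assms(2) by blast
    have "A v \<subseteq> nbhd G v"
      using A[OF v] by blast
    note image = coloring_join_within_image[OF assms(1) H_graph[unfolded H_def]
        g[unfolded H_def] t v this card_A[OF v]]
    show ?thesis
      using card_mono[OF _ image(1)] image(2) by simp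
  qed
  then have "chromatic_number H = t"
    using fH unfolding chromatic_number_def by (auto intro!: Least_equality)
  with hat show ?thesis
    by blast
qed

text \<open>All \<open>t\<close> colors must appear in the closed neighborhood of a vertex of
  minimum degree, which has only \<open>min_degree G + 1\<close> elements.\<close>

lemma Fall_le_min_degree:
  assumes "pair_graph G" "pverts G \<noteq> {}" "t \<in> Fall G"
  shows "t \<le> min_degree G + 1"
proof -
  have "min_degree G \<in> (\<lambda>v. out_degree (with_proj G) v) ` pverts G"
    unfolding min_degree_def by (rule Min_in) (use assms(2) finite_pverts[OF assms(1)] in auto)
  then obtain v where v: "v \<in> pverts G" and deg: "min_degree G = card (nbhd G v)"
    by (auto simp: out_degree_eq_card_nbhd)
  obtain f where "f ` closed_nbhd G v = {1..t}"
    using assms(3) v unfolding Fall_def fall_coloring_def by blast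
  then have "t \<le> card (closed_nbhd G v)"
    using card_image_le[of "closed_nbhd G v" f] finite_nbhd[OF assms(1)]
    by (simp add: closed_nbhd_def)
  then show ?thesis
    using not_in_nbhd_self[OF assms(1)] finite_nbhd[OF assms(1)]
    by (simp add: closed_nbhd_def deg)
qed

theorem theorem10:
  fixes G :: "'a pair_pre_digraph"
  assumes "pair_graph G"
    and "pverts G \<noteq> {}"
  shows "(\<forall>t::nat. 1 \<le> t \<and> t \<le> min_degree G + 1 \<longrightarrow>
            (t \<in> Fall G \<longleftrightarrow> t \<in> {chromatic_number H | H. H \<in> hat G t})) \<and>
         Fall G = (\<Union>i\<in>{1..min_degree G + 1}. {chromatic_number H | H. H \<in> hat G i} \<inter> {i})"
proof -
  have iff: "t \<in> Fall G \<longleftrightarrow> t \<in> {chromatic_number H | H. H \<in> hat G t}" if "1 \<le> t" for t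
    using Fall_if_chromatic_number_hat[OF assms(1) that] chromatic_number_hat_if_Fall[OF assms]
    by blast
  \<comment> \<open>These bounds confine \<open>Fall G\<close> to the index range of the
    union.\<close>
  have le: "1 \<le> t" "t \<le> min_degree G + 1" if "t \<in> Fall G" for t
    using that Fall_le_min_degree[OF assms that] by (simp_all add: Fall_def)
  have "Fall G = {t \<in> {1..min_degree G + 1}. t \<in> {chromatic_number H | H. H \<in> hat G t}}"
  proof (intro set_eqI iffI)
    fix t assume t: "t \<in> Fall G"
    with le[OF t] iff[OF le(1)[OF t]]
    show "t \<in> {t \<in> {1..min_degree G + 1}. t \<in> {chromatic_number H | H. H \<in> hat G t}}"
      by simp
  next
    fix t assume "t \<in> {t \<in> {1..min_degree G + 1}. t \<in> {chromatic_number H | H. H \<in> hat G t}}"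
    then show "t \<in> Fall G"
      using iff[of t] by simp
  qed
  \<comment> \<open>The index \<open>i\<close> contributes at most the element \<open>i\<close>, and
    does so exactly when some \<open>H \<in> hat G i\<close> has chromatic number
    \<open>i\<close>.\<close>
  also have "\<dots> = (\<Union>i\<in>{1..min_degree G + 1}. {chromatic_number H | H. H \<in> hat G i} \<inter> {i})"
    by blast
  finally show ?thesis
    using iff by simp
qed

end
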